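(* Let $q\in\mathbb{C}$ with $0<|q|<1$, and let $\mathcal{U}_n=\mathcal{U}_n(x,s,q)$ be the $q$-Chebyshev polynomials of the second kind. Then the generating function $G(z)=\sum_{n=0}^{\infty}\mathcal{U}_n(x,s,q)\,z^n$ is $$G(z)=\frac{1}{1-zx-(xqz+sqz^{2})\,\eta_z},$$ that is, $\bigl(1-xz-(xqz+sqz^2)\eta_z\bigr)G(z)=1$.
   Context: The $q$-Chebyshev polynomials of the second kind are defined by $\mathcal{U}_0(x,s,q)=1$, $\mathcal{U}_1(x,s,q)=(1+q)x$ and $$\mathcal{U}_{n}(x,s,q)=(1+q^{n})x\,\mathcal{U}_{n-1}(x,s,q)+q^{n-1}s\,\mathcal{U}_{n-2}(x,s,q)\qquad(n\ge 2),$$ where $x,s$ are indeterminates. Power series in $z$ are formal. $\eta_z$ is the operator on functions (formal power series) of $z$ defined by $\eta_z(f(z))=f(qz)$; an expression such as $(xqz+sqz^2)\eta_z$ means: first apply $\eta_z$, then multiply by $xqz+sqz^2$. The notation $\frac{f}{L}$, for an operator $L=1-a(z)-b(z)\,\eta_z$ on formal power series in $z$, where $a(z),b(z)$ are polynomials in $z$ with zero constant term acting by multiplication, and a series $f$, denotes the power series $G$ with $LG=f$. *)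

theory Defs
  imports "HOL-Computational_Algebra.Computational_Algebra" Complex_Main
begin

(* The ring \<complex>[x,s] of polynomials in the indeterminates x, s is represented as
   \<complex>[x][s], i.e. by the type of polynomials in s whose coefficients are
   polynomials in x. *)

type_synonym cpoly_xs = "complex poly poly"

definition const_xs :: "complex \<Rightarrow> cpoly_xs" where
  "const_xs c = [:[:c:]:]"

definition indet_x :: cpoly_xs where
  "indet_x = [:[:0, 1:]:]"

definition indet_s :: cpoly_xs where
  "indet_s = [:0, 1:]"

fun qcheb_U :: "'a::comm_ring_1 \<Rightarrow> 'a \<Rightarrow> 'a \<Rightarrow> nat \<Rightarrow> 'a" where
  "qcheb_U x s q 0 = 1"
| "qcheb_U x s q (Suc 0) = (1 + q) * x"
| "qcheb_U x s q (Suc (Suc n)) =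
     (1 + q ^ Suc (Suc n)) * x * qcheb_U x s q (Suc n) + q ^ Suc n * s * qcheb_U x s q n"

definition eta :: "'a::comm_ring_1 \<Rightarrow> 'a fps \<Rightarrow> 'a fps" where
  "eta q f = f oo (fps_const q * fps_X)"

(* The operator 1 - a(z) - b(z) eta, where a, b act by multiplication. *)

definition eta_operator :: "'a::comm_ring_1 \<Rightarrow> 'a fps \<Rightarrow> 'a fps \<Rightarrow> 'a fps \<Rightarrow> 'a fps" where
  "eta_operator q a b f = f - a * f - b * eta q f"

(* The quotient f / L: the series G with L G = f. As a definite description it carries
   information only if such a G exists and is unique. *)

definition op_quotient :: "'a fps \<Rightarrow> ('a fps \<Rightarrow> 'a fps) \<Rightarrow> 'a fps" where
  "op_quotient f L = (THE G. L G = f)"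

end

theory Submission
  imports Defs
begin

text \<open>
  The operator \<open>\<eta>\<close> multiplies the coefficient of \<open>z\<^sup>n\<close> by \<open>q\<^sup>n\<close>. Comparing coefficients in
  \<open>L G = 1\<close> therefore gives back, for \<open>n \<ge> 2\<close>, exactly the recurrence of the polynomials
  \<open>\<U>\<^sub>n\<close>, the summand \<open>q\<^sup>n x \<U>\<^sub>n\<^sub>-\<^sub>1\<close> coming from \<open>x q z \<eta>\<close> and the summand
  \<open>q\<^sup>n\<^sup>-\<^sup>1 s \<U>\<^sub>n\<^sub>-\<^sub>2\<close> from \<open>s q z\<^sup>2 \<eta>\<close>; for \<open>n = 0\<close> and \<open>n = 1\<close> it gives the initial values
  (lemma \<open>eta_operator_qcheb_U\<close>).

  For the quotient \<open>1 / L\<close> to be meaningful, the solution has to be unique. The operator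
  \<open>1 - a(z) - b(z) \<eta>\<close> is injective as soon as \<open>a\<close> and \<open>b\<close> have zero constant term, since the
  equation \<open>f = a f + b \<eta> f\<close> determines each coefficient of \<open>f\<close> from the earlier ones
  (lemma \<open>inj_eta_operator\<close>). Both facts hold over every commutative ring.
\<close>

lemma fps_nth_eta [simp]: "fps_nth (eta q f) n = q ^ n * fps_nth f n"
  by (simp add: eta_def fps_compose_linear)

lemma eta_diff: "eta q (f - g) = eta q f - eta q g"
  by (simp add: fps_eq_iff algebra_simps)

lemma eta_operator_diff:
  "eta_operator q a b (f - g) = eta_operator q a b f - eta_operator q a b g"
  by (simp add: eta_operator_def eta_diff algebra_simps)

lemma eta_operator_eq_0_imp_eq_0:
  fixes f :: "'a::comm_ring_1 fps"
  assumes a: "fps_nth a 0 = 0" and b: "fps_nth b 0 = 0" and f: "eta_operator q a b f = 0"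
  shows "f = 0"
proof -
  have rec: "f = a * f + b * eta q f"
    using f by (simp add: eta_operator_def algebra_simps)
  have "fps_nth f n = 0" for n
  proof (induction n rule: less_induct)
    case (less n)
    \<comment> \<open>In each convolution the term of index \<open>0\<close> vanishes because of the constant term, all
      others by the induction hypothesis.\<close>
    have "fps_nth a i * fps_nth f (n - i) = 0" if "i \<le> n" for i
      using a less.IH[of "n - i"] that by (cases "i = 0") auto
    moreover have "fps_nth b i * fps_nth (eta q f) (n - i) = 0" if "i \<le> n" for i
      using b less.IH[of "n - i"] that by (cases "i = 0") auto
    ultimately have "fps_nth (a * f + b * eta q f) n = 0"
      unfolding fps_add_nth fps_mult_nth by (simp del: fps_nth_eta)
    then show ?case
      using rec by simp
  qed
  then show ?thesis
    by (simp add: fps_eq_iff)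
qed

lemma inj_eta_operator:
  fixes a b :: "'a::comm_ring_1 fps"
  assumes "fps_nth a 0 = 0" and "fps_nth b 0 = 0"
  shows "inj (eta_operator q a b)"
proof (rule injI)
  fix f g
  assume "eta_operator q a b f = eta_operator q a b g"
  then have "eta_operator q a b (f - g) = 0"
    by (simp add: eta_operator_diff)
  then have "f - g = 0"
    by (rule eta_operator_eq_0_imp_eq_0[OF assms])
  then show "f = g"
    by simp
qed

lemma op_quotient_eqI:
  assumes "inj L" and "L G = f"
  shows "op_quotient f L = G"
  unfolding op_quotient_def using assms by (auto intro: the_equality dest: injD)

lemma eta_operator_qcheb_U:
  fixes x s q :: "'a::comm_ring_1"
  shows "eta_operator q (fps_const x * fps_X)
           (fps_const (x * q) * fps_X + fps_const (s * q) * fps_X ^ 2)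
           (Abs_fps (\<lambda>n. qcheb_U x s q n)) = 1"
    (is "eta_operator q ?a ?b ?G = 1")
proof (rule fps_ext)
  fix n
  have coeff: "fps_nth (eta_operator q ?a ?b ?G) n =
      fps_nth ?G n - x * fps_nth (fps_X * ?G) n
        - (x * q * fps_nth (fps_X * eta q ?G) n + s * q * fps_nth (fps_X ^ 2 * eta q ?G) n)"
    by (simp only: eta_operator_def fps_sub_nth fps_add_nth distrib_right mult.assoc
        fps_mult_left_const_nth)
  consider "n = 0" | "n = 1" | m where "n = Suc (Suc m)"
    by (metis One_nat_def not0_implies_Suc)
  then show "fps_nth (eta_operator q ?a ?b ?G) n = fps_nth 1 n"
    unfolding coeff by cases (auto simp: fps_X_power_mult_nth algebra_simps)
qed

theorem theorem1:
  fixes q :: complex and x s Q :: cpoly_xs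
    and G :: "cpoly_xs fps" and L :: "cpoly_xs fps \<Rightarrow> cpoly_xs fps"
  assumes q: "0 < cmod q" "cmod q < 1"
  defines "x \<equiv> indet_x" and "s \<equiv> indet_s" and "Q \<equiv> const_xs q"
  defines "G \<equiv> Abs_fps (\<lambda>n. qcheb_U x s Q n)"
    and "L \<equiv> eta_operator Q (fps_const x * fps_X)
               (fps_const (x * Q) * fps_X + fps_const (s * Q) * fps_X ^ 2)"
  shows "G = op_quotient 1 L \<and> L G = 1"
proof -
  have LG: "L G = 1"
    unfolding L_def G_def by (rule eta_operator_qcheb_U)
  have "inj L"
    unfolding L_def by (rule inj_eta_operator) simp_all
  then show ?thesis
    using op_quotient_eqI LG by metis
qed

end
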